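(* Let $p\in[1,\infty)$. Then $$\mathscr{M}_{\mathrm{op}}(d_p)=\{R\in\mathscr{L}(d_p): RS=SR\}.$$ Moreover, $$\mathscr{M}_{\mathrm{op}}(d_p)=\mathscr{M}_{\mathrm{op}}(d_p)^c=\mathscr{M}_{\mathrm{op}}(d_p)^{cc}.$$
   Context: Let $\mathbb{N}_0=\{0,1,2,\dots\}$. For $p\in[1,\infty)$, $d_p$ is the Banach space of all complex sequences $a=(a_n)_{n=0}^\infty$ with $\|a\|_{d_p}:=\big(\sum_{n=0}^\infty\sup_{k\ge n}|a_k|^p\big)^{1/p}<\infty$. The convolution of $a,b\in\mathbb{C}^{\mathbb{N}_0}$ is $(a*b)_n:=\sum_{j=0}^n a_jb_{n-j}$, $n\in\mathbb{N}_0$. The multiplier algebra of $d_p$ is $\mathscr{M}(d_p):=\{b\in\mathbb{C}^{\mathbb{N}_0}: a*b\in d_p \text{ for all } a\in d_p\}$. $\mathscr{L}(d_p)$ is the Banach algebra of all bounded linear operators from $d_p$ into itself. For $b\in\mathscr{M}(d_p)$, $T_b\in\mathscr{L}(d_p)$ is the (automatically bounded) convolution operator $T_b(a):=a*b$, and $\mathscr{M}_{\mathrm{op}}(d_p):=\{T_b: b\in\mathscr{M}(d_p)\}\subseteq\mathscr{L}(d_p)$. The right-shift $S\in\mathscr{L}(d_p)$ is $S(a_0,a_1,\dots)=(0,a_0,a_1,\dots)$. The commutant is $\mathscr{M}_{\mathrm{op}}(d_p)^c:=\{R\in\mathscr{L}(d_p): T_bR=RT_b \text{ for all } b\in\mathscr{M}(d_p)\}$,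 and $\mathscr{M}_{\mathrm{op}}(d_p)^{cc}$ is the commutant in $\mathscr{L}(d_p)$ of $\mathscr{M}_{\mathrm{op}}(d_p)^c$. *)

theory Defs
  imports Complex_Main "HOL-Library.FuncSet" "HOL-Library.Extended_Nonnegative_Real"
begin

text \<open>
  The space \<open>d\<^sub>p\<close> depends on the real number \<open>p\<close>, so it is a set of sequences rather than a type.
  The sum of suprema is taken in \<^typ>\<open>ennreal\<close>, where it exists for every sequence;
  \<open>dp_norm p a\<close> is meaningful only for \<open>a \<in> dp p\<close>.
\<close>

definition dp_sum :: "real \<Rightarrow> (nat \<Rightarrow> complex) \<Rightarrow> ennreal" where
  "dp_sum p a = (\<Sum>n. SUP k\<in>{n..}. ennreal (norm (a k) powr p))"

definition dp :: "real \<Rightarrow> (nat \<Rightarrow> complex) set" where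
  "dp p = {a. dp_sum p a < \<infinity>}"

definition dp_norm :: "real \<Rightarrow> (nat \<Rightarrow> complex) \<Rightarrow> real" where
  "dp_norm p a = enn2real (dp_sum p a) powr (1 / p)"

definition conv :: "(nat \<Rightarrow> complex) \<Rightarrow> (nat \<Rightarrow> complex) \<Rightarrow> nat \<Rightarrow> complex" where
  "conv a b n = (\<Sum>j\<le>n. a j * b (n - j))"

definition multipliers :: "real \<Rightarrow> (nat \<Rightarrow> complex) set" where
  "multipliers p = {b. \<forall>a\<in>dp p. conv a b \<in> dp p}"

text \<open>
  Operators on \<open>d\<^sub>p\<close> are extensional functions (\<open>undefined\<close> outside \<open>dp p\<close>), so that equality
  of operators is agreement on \<open>dp p\<close>; products of operators are formed with \<^const>\<open>compose\<close>.
\<close>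

definition bounded_ops :: "real \<Rightarrow> ((nat \<Rightarrow> complex) \<Rightarrow> nat \<Rightarrow> complex) set" where
  "bounded_ops p = {R \<in> dp p \<rightarrow>\<^sub>E dp p.
     (\<forall>a\<in>dp p. \<forall>b\<in>dp p. R (\<lambda>n. a n + b n) = (\<lambda>n. R a n + R b n)) \<and>
     (\<forall>c. \<forall>a\<in>dp p. R (\<lambda>n. c * a n) = (\<lambda>n. c * R a n)) \<and>
     (\<exists>C. \<forall>a\<in>dp p. dp_norm p (R a) \<le> C * dp_norm p a)}"

definition conv_op :: "real \<Rightarrow> (nat \<Rightarrow> complex) \<Rightarrow> (nat \<Rightarrow> complex) \<Rightarrow> nat \<Rightarrow> complex" where
  "conv_op p b = (\<lambda>a\<in>dp p. conv a b)"

definition multiplier_ops :: "real \<Rightarrow> ((nat \<Rightarrow> complex) \<Rightarrow> nat \<Rightarrow> complex) set" where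
  "multiplier_ops p = conv_op p ` multipliers p"

definition right_shift :: "real \<Rightarrow> (nat \<Rightarrow> complex) \<Rightarrow> nat \<Rightarrow> complex" where
  "right_shift p = (\<lambda>a\<in>dp p. case_nat 0 a)"

definition commutant ::
  "real \<Rightarrow> ((nat \<Rightarrow> complex) \<Rightarrow> nat \<Rightarrow> complex) set \<Rightarrow> ((nat \<Rightarrow> complex) \<Rightarrow> nat \<Rightarrow> complex) set" where
  "commutant p A = {R \<in> bounded_ops p. \<forall>T\<in>A. compose (dp p) T R = compose (dp p) R T}"

end

theory Submission
  imports Defs "HOL-Analysis.Analysis"
begin

text \<open>
  Everything rests on \<open>right_shift p\<close> being itself a multiplier operator, namely convolution with
  the sequence \<open>(0, 1, 0, 0, \<dots>)\<close>. Multiplier operators commute with one another because convolution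
  is commutative and associative, so they lie in their own commutant; an operator in the
  commutant commutes in particular with the shift; and an operator commuting with the shift is a
  multiplier operator. This closes a circle of inclusions, and the statement on the double
  commutant follows formally.

  An operator \<open>R\<close> commuting with the shift is convolution with \<open>R unit_seq\<close>, where
  \<open>unit_seq = (1, 0, 0, \<dots>)\<close>. Splitting \<open>a\<close> as \<open>a 0\<close> times \<open>unit_seq\<close> plus the shift of the
  tail of \<open>a\<close> gives \<open>R a\<close> the recursion, one coordinate at a time, that also determines the
  convolution (lemma \<open>shift_commuting_eq_conv\<close>).

  The analytic part is that convolution with a multiplier is a bounded operator at all. It is a case
  of a closed graph theorem (lemma \<open>dp_sum_bound_if_coordinatewise_continuous\<close>), obtained from
  Baire's theorem in the space of all sequences with the topology of coordinatewise convergence,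
  which is completely metrizable and does not depend on \<open>p\<close>. The sets \<open>{a. dp_sum p a \<le> m}\<close> are
  closed there, as \<open>dp_sum p\<close> is a supremum of continuous functions (lemma \<open>dp_sum_le_iff\<close>), and
  they are convex since \<open>dp_sum p\<close> is a convex function.
\<close>

section \<open>Convolution\<close>

text \<open>
  Commutativity and associativity of convolution are inherited from the ring of formal power series.
\<close>

lemma conv_eq_fps_mult: "conv a b = fps_nth (Abs_fps a * Abs_fps b)"
  by (simp add: fun_eq_iff conv_def fps_mult_nth atLeast0AtMost)

lemma conv_commute: "conv a b = conv b a"
  by (simp add: conv_eq_fps_mult mult.commute)

lemma conv_conv_commute: "conv (conv a b) c = conv (conv a c) b"
  by (simp add: conv_eq_fps_mult fps_nth_inverse mult_ac)

lemma conv_add_left: "conv (\<lambda>n. a n + b n) c = (\<lambda>n. conv a c n + conv b c n)"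
  by (simp add: fun_eq_iff conv_def algebra_simps sum.distrib)

lemma conv_scale_left: "conv (\<lambda>n. z * a n) c = (\<lambda>n. z * conv a c n)"
  by (simp add: fun_eq_iff conv_def sum_distrib_left mult.assoc)

lemma conv_0: "conv a b 0 = a 0 * b 0"
  by (simp add: conv_def)

lemma conv_Suc: "conv a b (Suc n) = a 0 * b (Suc n) + conv (\<lambda>n. a (Suc n)) b n"
  unfolding conv_def by (subst sum.atMost_Suc_shift) simp

abbreviation unit_seq :: "nat \<Rightarrow> complex" where
  "unit_seq \<equiv> case_nat 1 (\<lambda>_. 0)"

lemma conv_unit_seq_left: "conv unit_seq a = a"
proof
  fix n
  show "conv unit_seq a n = a n"
    by (cases n) (simp_all add: conv_0 conv_Suc, simp add: conv_def)
qed

lemma conv_shifted_unit_seq: "conv a (case_nat 0 unit_seq) = case_nat 0 a"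
proof
  fix n
  show "conv a (case_nat 0 unit_seq) n = case_nat 0 a n"
    by (subst conv_commute, cases n) (simp_all add: conv_0 conv_Suc conv_unit_seq_left)
qed

section \<open>The sum of suprema\<close>

lemma norm_powr_le_dp_sum: "ennreal (norm (a k) powr p) \<le> dp_sum p a"
proof -
  have "ennreal (norm (a k) powr p) \<le> (SUP j\<in>{0..}. ennreal (norm (a j) powr p))"
    by (rule SUP_upper) simp
  also have "\<dots> \<le> dp_sum p a"
    unfolding dp_sum_def
    using sum_le_suminf[of "\<lambda>n. SUP k\<in>{n..}. ennreal (norm (a k) powr p)" "{0}"] by simp
  finally show ?thesis .
qed

lemma dp_sum_scale:
  "dp_sum p (\<lambda>n. z * a n) = ennreal (norm z powr p) * dp_sum p a"
  unfolding dp_sum_def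
  by (simp add: norm_mult powr_mult ennreal_mult' SUP_mult_left_ennreal flip: ennreal_suminf_cmult)

lemma powr_convex_combination:
  fixes x y t p :: real
  assumes p: "1 \<le> p" and "0 \<le> x" "0 \<le> y" and t: "0 \<le> t" "t \<le> 1"
  shows "((1 - t) * x + t * y) powr p \<le> (1 - t) * x powr p + t * y powr p"
proof -
  \<comment> \<open>When \<open>x\<close> or \<open>y\<close> is 0, the claim reduces to this bound on the weight of the other point.\<close>
  have shrink: "s powr p \<le> s" if "0 \<le> s" "s \<le> 1" for s :: real
    using powr_mono'[of 1 p s] that p by (cases "s = 0") auto
  consider "0 < x" "0 < y" | "x = 0" | "y = 0"
    using assms by linarith
  then show ?thesis
  proof cases
    case 1
    then show ?thesis
      using convex_onD[OF powr_convex[OF p] t, of x y] by simp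
  next
    case 2
    then show ?thesis
      using mult_right_mono[OF shrink[OF t], of "y powr p"] p t assms by (simp add: powr_mult)
  next
    case 3
    then show ?thesis
      using mult_right_mono[OF shrink[of "1 - t"], of "x powr p"] p t assms by (simp add: powr_mult)
  qed
qed

text \<open>
  Convexity stands in for the triangle inequality: it makes the set \<open>{a. dp_sum p a \<le> 1}\<close> convex, and
  together with homogeneity it yields the quasi-triangle inequality \<open>dp_sum_add\<close> below.
\<close>

lemma dp_sum_convex:
  assumes p: "1 \<le> p" and t: "0 \<le> t" "t \<le> 1"
  shows "dp_sum p (\<lambda>n. complex_of_real (1 - t) * a n + complex_of_real t * b n)
           \<le> ennreal (1 - t) * dp_sum p a + ennreal t * dp_sum p b"
proof -
  let ?s = "\<lambda>a n. SUP k\<in>{n..}. ennreal (norm (a k :: complex) powr p)"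
  let ?c = "\<lambda>n. complex_of_real (1 - t) * a n + complex_of_real t * b n"
  have le: "?s ?c n \<le> ennreal (1 - t) * ?s a n + ennreal t * ?s b n" for n
  proof (rule SUP_least)
    fix k assume k: "k \<in> {n..}"
    have "norm (?c k) \<le> (1 - t) * norm (a k) + t * norm (b k)"
      using norm_triangle_ineq[of "complex_of_real (1 - t) * a k" "complex_of_real t * b k"] t
      by (simp add: norm_mult del: of_real_diff)
    then have "norm (?c k) powr p \<le> ((1 - t) * norm (a k) + t * norm (b k)) powr p"
      using p by (intro powr_mono2) auto
    also have "\<dots> \<le> (1 - t) * norm (a k) powr p + t * norm (b k) powr p"
      using p t by (intro powr_convex_combination) auto
    finally have "ennreal (norm (?c k) powr p)
        \<le> ennreal (1 - t) * ennreal (norm (a k) powr p) + ennreal t * ennreal (norm (b k) powr p)"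
      using t by (simp flip: ennreal_mult ennreal_plus)
    also have "\<dots> \<le> ennreal (1 - t) * ?s a n + ennreal t * ?s b n"
      using k by (intro add_mono mult_left_mono SUP_upper) auto
    finally show "ennreal (norm (?c k) powr p) \<le> ennreal (1 - t) * ?s a n + ennreal t * ?s b n" .
  qed
  have "dp_sum p ?c \<le> (\<Sum>n. ennreal (1 - t) * ?s a n + ennreal t * ?s b n)"
    unfolding dp_sum_def using le by (intro suminf_le) auto
  also have "\<dots> = ennreal (1 - t) * dp_sum p a + ennreal t * dp_sum p b"
    unfolding dp_sum_def by (subst suminf_add[symmetric]) auto
  finally show ?thesis .
qed

lemma dp_sum_add:
  assumes p: "1 \<le> p"
  shows "dp_sum p (\<lambda>n. a n + b n) \<le> ennreal (2 powr p) * (dp_sum p a + dp_sum p b)"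
proof -
  have "dp_sum p (\<lambda>n. a n + b n)
      = dp_sum p (\<lambda>n. complex_of_real (1 - 1/2) * (2 * a n) + complex_of_real (1/2) * (2 * b n))"
    by simp
  also have "\<dots> \<le> ennreal (1 - 1/2) * dp_sum p (\<lambda>n. 2 * a n) + ennreal (1/2) * dp_sum p (\<lambda>n. 2 * b n)"
    by (rule dp_sum_convex[OF p]) auto
  also have "\<dots> \<le> 1 * dp_sum p (\<lambda>n. 2 * a n) + 1 * dp_sum p (\<lambda>n. 2 * b n)"
    by (intro add_mono mult_right_mono ennreal_le_1[THEN iffD2]) auto
  also have "\<dots> = ennreal (2 powr p) * (dp_sum p a + dp_sum p b)"
    by (simp add: dp_sum_scale distrib_left)
  finally show ?thesis .
qed

text \<open>
  The suprema of the prolonged sequence at positions \<open>n + 1\<close> are those of \<open>a\<close> at \<open>n\<close>. The only new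
  one is at position \<open>0\<close>, and any entry of \<open>a\<close> is already dominated by \<open>dp_sum p a\<close>.
\<close>

lemma dp_sum_case_nat:
  "dp_sum p (case_nat z a) \<le> ennreal (norm z powr p) + 2 * dp_sum p a"
proof -
  let ?s = "\<lambda>a n. SUP k\<in>{n..}. ennreal (norm (a k :: complex) powr p)"
  let ?c = "case_nat z a"
  have 0: "?s ?c 0 \<le> ennreal (norm z powr p) + dp_sum p a"
  proof (rule SUP_least)
    fix k :: nat
    show "ennreal (norm (?c k) powr p) \<le> ennreal (norm z powr p) + dp_sum p a"
      using norm_powr_le_dp_sum[of a "k - 1" p] by (cases k) (auto intro: add_increasing)
  qed
  have Suc: "?s ?c (Suc n) = ?s a n" for n
  proof -
    have "{Suc n..} = Suc ` {n..}"
      by (auto simp: image_iff dest: Suc_le_D)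
    then show ?thesis
      by (simp add: image_image)
  qed
  have "dp_sum p ?c = (\<Sum>n. ?s ?c (n + 1)) + (\<Sum>n<1. ?s ?c n)"
    unfolding dp_sum_def by (rule suminf_offset) simp
  also have "\<dots> = dp_sum p a + ?s ?c 0"
    using Suc by (simp add: dp_sum_def)
  also have "\<dots> \<le> dp_sum p a + (ennreal (norm z powr p) + dp_sum p a)"
    by (intro add_left_mono 0)
  finally show ?thesis
    by (simp add: mult_2 add.left_commute)
qed

lemma dp_sum_tail: "dp_sum p (\<lambda>n. a (Suc n)) \<le> dp_sum p a"
  unfolding dp_sum_def
proof (intro suminf_le SUP_least)
  fix n k :: nat assume "k \<in> {n..}"
  then show "ennreal (norm (a (Suc k)) powr p) \<le> (SUP k\<in>{n..}. ennreal (norm (a k) powr p))"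
    by (intro SUP_upper2[of "Suc k"]) auto
qed auto

text \<open>
  A finite sum of suprema is approached by choosing one term in each supremum. The summand \<open>c\<close> takes
  up, in the induction, the terms whose supremum has already been resolved.
\<close>

lemma sum_SUP_le:
  fixes f :: "nat \<Rightarrow> 'a \<Rightarrow> ennreal"
  assumes "\<And>n. I n \<noteq> {}"
    and "\<And>\<kappa>. (\<And>n. \<kappa> n \<in> I n) \<Longrightarrow> (\<Sum>n<N. f n (\<kappa> n)) + c \<le> m"
  shows "(\<Sum>n<N. SUP k\<in>I n. f n k) + c \<le> m"
  using assms(2)
proof (induction N arbitrary: c)
  case 0
  have "(SOME k. k \<in> I n) \<in> I n" for n
    using assms(1) by (simp add: some_in_eq)
  from 0[of "\<lambda>n. SOME k. k \<in> I n", OF this] show ?case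
    by simp
next
  case (Suc N)
  have "(\<Sum>n<N. SUP k\<in>I n. f n k) + (f N k + c) \<le> m" if "k \<in> I N" for k
  proof (rule Suc.IH)
    fix \<kappa> assume \<kappa>: "\<And>n. \<kappa> n \<in> I n"
    have "(\<Sum>n<N. f n ((\<kappa>(N := k)) n)) = (\<Sum>n<N. f n (\<kappa> n))"
      by (rule sum.cong) auto
    then show "(\<Sum>n<N. f n (\<kappa> n)) + (f N k + c) \<le> m"
      using Suc.prems[of "\<kappa>(N := k)"] \<kappa> that by (simp add: add.assoc)
  qed
  then have "(SUP k\<in>I N. f N k + ((\<Sum>n<N. SUP k\<in>I n. f n k) + c)) \<le> m"
    by (intro SUP_least) (simp add: ac_simps)
  then show ?case
    by (simp add: ennreal_SUP_add_left[OF assms(1)] add.assoc add.left_commute)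
qed

text \<open>
  Each side condition on the right depends on finitely many coordinates of \<open>a\<close> and is continuous in
  them; this is what makes \<open>dp_sum p\<close> lower semicontinuous for coordinatewise convergence.
\<close>

lemma dp_sum_le_iff:
  "dp_sum p a \<le> m \<longleftrightarrow>
     (\<forall>N \<kappa>. (\<forall>n. n \<le> \<kappa> n) \<longrightarrow> (\<Sum>n<N. ennreal (norm (a (\<kappa> n)) powr p)) \<le> m)"
proof (intro iffI allI impI)
  fix N :: nat and \<kappa> :: "nat \<Rightarrow> nat"
  assume le: "dp_sum p a \<le> m" and \<kappa>: "\<forall>n. n \<le> \<kappa> n"
  have "(\<Sum>n<N. ennreal (norm (a (\<kappa> n)) powr p)) \<le> (\<Sum>n<N. SUP k\<in>{n..}. ennreal (norm (a k) powr p))"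
    using \<kappa> by (intro sum_mono SUP_upper) auto
  also have "\<dots> \<le> dp_sum p a"
    unfolding dp_sum_def by (rule sum_le_suminf) auto
  finally show "(\<Sum>n<N. ennreal (norm (a (\<kappa> n)) powr p)) \<le> m"
    using le by simp
next
  assume *: "\<forall>N \<kappa>. (\<forall>n. n \<le> \<kappa> n) \<longrightarrow> (\<Sum>n<N. ennreal (norm (a (\<kappa> n)) powr p)) \<le> m"
  have "(\<Sum>n<N. SUP k\<in>{n..}. ennreal (norm (a k) powr p)) + 0 \<le> m" for N
    by (rule sum_SUP_le) (use * in auto)
  then show "dp_sum p a \<le> m"
    unfolding dp_sum_def using ennreal_suminf_bound_add[where y = 0] by auto
qed

lemma closed_dp_sum_le:
  assumes p: "1 \<le> p"
  shows "closed {a. dp_sum p a \<le> m}"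
proof (cases m)
  case (real r)
  have "closed {a. (\<Sum>n<N. ennreal (norm (a (\<kappa> n) :: complex) powr p)) \<le> m}"
    for N and \<kappa> :: "nat \<Rightarrow> nat"
  proof -
    have "continuous_on UNIV (\<lambda>a. \<Sum>n<N. norm (a (\<kappa> n) :: complex) powr p)"
      using p by (intro continuous_intros continuous_on_powr') auto
    from closed_Collect_le[OF this continuous_on_const[of _ r]] show ?thesis
      using real by (simp add: sum_nonneg)
  qed
  then have "closed (\<Inter>N. \<Inter>\<kappa>\<in>{\<kappa>. \<forall>n::nat. n \<le> \<kappa> n}.
      {a. (\<Sum>n<N. ennreal (norm (a (\<kappa> n) :: complex) powr p)) \<le> m})"
    by (intro closed_INT ballI) simp
  also have "\<dots> = {a. dp_sum p a \<le> m}"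
    by (auto simp: dp_sum_le_iff)
  finally show ?thesis .
qed simp

section \<open>Closure of \<open>d\<^sub>p\<close>\<close>

lemma dp_iff_le: "a \<in> dp p \<longleftrightarrow> (\<exists>m::nat. dp_sum p a \<le> ennreal (real m))"
proof
  assume "a \<in> dp p"
  then obtain r where r: "0 \<le> r" "dp_sum p a = ennreal r"
    unfolding dp_def by (cases "dp_sum p a") auto
  obtain m :: nat where "r \<le> real m" using real_arch_simple by blast
  then show "\<exists>m::nat. dp_sum p a \<le> ennreal (real m)"
    using r by (auto intro: ennreal_leI)
next
  assume "\<exists>m::nat. dp_sum p a \<le> ennreal (real m)"
  then show "a \<in> dp p"
    unfolding dp_def by (auto intro: le_less_trans)
qed

lemma dp_add: "1 \<le> p \<Longrightarrow> a \<in> dp p \<Longrightarrow> b \<in> dp p \<Longrightarrow> (\<lambda>n. a n + b n) \<in> dp p"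
  using dp_sum_add[of p a b] unfolding dp_def
  by (auto simp: less_top[symmetric] top_unique ennreal_mult_eq_top_iff)

lemma dp_scale: "a \<in> dp p \<Longrightarrow> (\<lambda>n. z * a n) \<in> dp p"
  unfolding dp_def by (simp add: dp_sum_scale ennreal_mult_less_top)

lemma dp_zero: "(\<lambda>_. 0) \<in> dp p"
  by (simp add: dp_def dp_sum_def)

lemma dp_case_nat: "a \<in> dp p \<Longrightarrow> case_nat z a \<in> dp p"
  using dp_sum_case_nat[of p z a] unfolding dp_def
  by (auto simp: less_top[symmetric] top_unique ennreal_mult_eq_top_iff)

lemma dp_tail: "a \<in> dp p \<Longrightarrow> (\<lambda>n. a (Suc n)) \<in> dp p"
  using dp_sum_tail[of p a] unfolding dp_def by auto


section \<open>Automatic boundedness\<close>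

lemma dp_sum_eq_0D:
  assumes "dp_sum p a = 0"
  shows "a = (\<lambda>_. 0)"
  using norm_powr_le_dp_sum[of a _ p] assms by (auto simp: fun_eq_iff ennreal_eq_0_iff)

lemma norm_le_1_if_dp_sum_le_1:
  assumes "1 \<le> p" "dp_sum p a \<le> 1"
  shows "norm (a k) \<le> 1"
proof (rule ccontr)
  assume "\<not> norm (a k) \<le> 1"
  then have "1 < norm (a k) powr p"
    using assms(1) by (intro gr_one_powr) auto
  moreover have "ennreal (norm (a k) powr p) \<le> 1"
    using norm_powr_le_dp_sum assms(2) by (rule order_trans)
  ultimately show False
    by simp
qed

text \<open>
  Let \<open>B\<close> be the set \<open>{a. dp_sum p a \<le> 1}\<close>. It is the union of the closed sets \<open>F m\<close> on which
  \<open>dp_sum p (T a) \<le> m\<close>, so by Baire's theorem some \<open>F m\<close> contains all points of \<open>B\<close> that are close to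
  a point \<open>c\<close> of \<open>B\<close> in finitely many coordinates. The entries of points of \<open>B\<close> have modulus at
  most 1, so a fixed small \<open>t\<close> brings \<open>(1 - t) c + t a\<close> that close to \<open>c\<close> for every \<open>a\<close> in \<open>B\<close>, while
  convexity keeps it in \<open>B\<close>. Thus \<open>dp_sum p\<close> of its image is at most \<open>m\<close>, and solving for \<open>a\<close> bounds
  \<open>dp_sum p (T a)\<close> uniformly over \<open>B\<close>.
\<close>

lemma dp_sum_bound_if_coordinatewise_continuous:
  fixes T :: "(nat \<Rightarrow> complex) \<Rightarrow> nat \<Rightarrow> complex"
  assumes p: "1 \<le> p"
    and cont: "continuous_on UNIV T"
    and add: "\<And>a b. T (\<lambda>n. a n + b n) = (\<lambda>n. T a n + T b n)"
    and scale: "\<And>z a. T (\<lambda>n. z * a n) = (\<lambda>n. z * T a n)"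
    and maps: "\<And>a. a \<in> dp p \<Longrightarrow> T a \<in> dp p"
  obtains K where "0 \<le> K" "\<And>a. a \<in> dp p \<Longrightarrow> dp_sum p (T a) \<le> ennreal K * dp_sum p a"
proof -
  define B where "B = {a :: nat \<Rightarrow> complex. dp_sum p a \<le> 1}"
  define F where "F m = B \<inter> T -` {a. dp_sum p a \<le> ennreal (real m)}" for m
  have closed_B: "closed B"
    unfolding B_def by (rule closed_dp_sum_le[OF p])
  have closed_F: "closed (F m)" for m
    unfolding F_def using closed_dp_sum_le[OF p] cont by (intro closed_Int closed_B closed_vimage)
  have B_dp: "B \<subseteq> dp p"
    using dp_iff_le[of _ p] unfolding B_def by (force intro: exI[of _ 1])
  have union_F: "\<Union> (range F) = B"
  proof
    show "B \<subseteq> \<Union> (range F)"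
    proof
      fix a assume "a \<in> B"
      then obtain m :: nat where "dp_sum p (T a) \<le> ennreal (real m)"
        using maps[of a] B_dp dp_iff_le[of "T a" p] by auto
      then show "a \<in> \<Union> (range F)"
        using \<open>a \<in> B\<close> by (auto simp: F_def)
    qed
  qed (auto simp: F_def)
  have "\<exists>m. top_of_set B interior_of F m \<noteq> {}"
  proof (rule ccontr)
    assume *: "\<nexists>m. top_of_set B interior_of F m \<noteq> {}"
    have "top_of_set B interior_of \<Union> (range F) = {}"
    proof (rule Baire_category_alt)
      show "completely_metrizable_space (top_of_set B) \<or>
          locally_compact_space (top_of_set B) \<and> regular_space (top_of_set B)"
        using closed_B completely_metrizable_space_closedin completely_metrizable_space_euclidean
        by (metis closed_closedin)
      show "closedin (top_of_set B) S \<and> top_of_set B interior_of S = {}" if "S \<in> range F" for S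
        using that * closed_F by (auto simp: F_def intro!: closed_subset)
    qed simp
    moreover have "(\<lambda>_. 0) \<in> B"
      by (simp add: B_def dp_sum_def)
    ultimately show False
      using interior_of_topspace[of "top_of_set B"] union_F by auto
  qed
  then obtain m c where c: "c \<in> top_of_set B interior_of F m"
    by blast
  then obtain U where U: "open U" "c \<in> U" "B \<inter> U \<subseteq> F m" and "c \<in> B"
    unfolding interior_of_def by (auto simp: openin_open)
  \<comment> \<open>A basic neighbourhood of \<open>c\<close> restricts only finitely many coordinates.\<close>
  from product_topology_open_contains_basis[OF U(1)[unfolded open_fun_def] U(2)]
  obtain X where X: "c \<in> Pi\<^sub>E UNIV X" "\<And>i. open (X i)" "finite {i. X i \<noteq> UNIV}" "Pi\<^sub>E UNIV X \<subseteq> U"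
    by auto
  have "\<forall>i. \<exists>e>0. ball (c i) e \<subseteq> X i"
    using X(1,2) by (metis PiE_mem UNIV_I open_contains_ball)
  then obtain e where e: "\<And>i. 0 < e i" "\<And>i. ball (c i) (e i) \<subseteq> X i"
    by metis
  \<comment> \<open>Entries of two points of \<open>B\<close> differ by at most 2, so moving the fraction \<open>t\<close> of the way from
      \<open>c\<close> changes each coordinate by at most \<open>2 t\<close>. The inserted 1 gives \<open>t \<le> 1\<close> and covers the
      case that no coordinate is restricted.\<close>
  define t where "t = Min (insert 1 (e ` {i. X i \<noteq> UNIV})) / 4"
  have fin: "finite (insert 1 (e ` {i. X i \<noteq> UNIV}))"
    using X(3) by simp
  have Min_pos: "0 < Min (insert 1 (e ` {i. X i \<noteq> UNIV}))"
    using fin e(1) by (subst Min_gr_iff) auto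
  then have t_pos: "0 < t"
    by (simp add: t_def)
  have t_le_1: "t \<le> 1"
    using Min_le[OF fin, of 1] by (simp add: t_def)
  have t_less: "2 * t < e i" if "X i \<noteq> UNIV" for i
  proof -
    have "Min (insert 1 (e ` {i. X i \<noteq> UNIV})) \<le> e i"
      using that by (intro Min_le[OF fin]) auto
    then show ?thesis
      using Min_pos by (simp add: t_def)
  qed
  \<comment> \<open>The coefficients that recover \<open>a\<close> from \<open>(1 - t) c + t a\<close> and \<open>c\<close>.\<close>
  define z where "z = complex_of_real (1 / t)"
  define w where "w = - complex_of_real ((1 - t) / t)"
  \<comment> \<open>The constant of the quasi-triangle inequality, with both images bounded by \<open>m\<close>.\<close>
  define K where "K = 2 powr p * (norm z powr p * m + norm w powr p * m)"
  have K: "0 \<le> K"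
    by (simp add: K_def)
  have T_c: "dp_sum p (T c) \<le> ennreal m"
    using U(2,3) \<open>c \<in> B\<close> by (auto simp: F_def)
  have T_B: "dp_sum p (T a) \<le> ennreal K" if a: "a \<in> B" for a
  proof -
    define y where "y = (\<lambda>n. complex_of_real (1 - t) * c n + complex_of_real t * a n)"
    have "dp_sum p y \<le> ennreal (1 - t) * dp_sum p c + ennreal t * dp_sum p a"
      unfolding y_def using t_pos t_le_1 by (intro dp_sum_convex[OF p]) auto
    also have "\<dots> \<le> ennreal (1 - t) * 1 + ennreal t * 1"
      using a \<open>c \<in> B\<close> by (intro add_mono mult_left_mono) (auto simp: B_def)
    also have "\<dots> = 1"
      using t_pos t_le_1 by (simp flip: ennreal_plus)
    finally have "y \<in> B"
      by (simp add: B_def)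
    moreover have "y i \<in> X i" for i
    proof (cases "X i = UNIV")
      case False
      have "c i - y i = complex_of_real t * (c i - a i)"
        by (simp add: y_def algebra_simps)
      then have "dist (c i) (y i) = t * norm (c i - a i)"
        using t_pos by (simp add: dist_norm norm_mult)
      also have "\<dots> \<le> t * (1 + 1)"
        using a \<open>c \<in> B\<close> p t_pos unfolding B_def
        by (intro mult_left_mono order_trans[OF norm_triangle_ineq4] add_mono norm_le_1_if_dp_sum_le_1) auto
      finally show ?thesis
        using t_less[OF False] e(2)[of i] by auto
    qed simp
    then have "y \<in> U"
      using X(4) by auto
    ultimately have T_y: "dp_sum p (T y) \<le> ennreal m"
      using U(3) by (auto simp: F_def)
    have "a = (\<lambda>n. z * y n + w * c n)"
      using t_pos by (simp add: fun_eq_iff y_def z_def w_def field_simps)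
    then have "T a = (\<lambda>n. z * T y n + w * T c n)"
      by (simp only: add scale)
    then have "dp_sum p (T a)
        \<le> ennreal (2 powr p) * (ennreal (norm z powr p) * dp_sum p (T y) + ennreal (norm w powr p) * dp_sum p (T c))"
      using dp_sum_add[OF p, of "\<lambda>n. z * T y n" "\<lambda>n. w * T c n"] by (simp add: dp_sum_scale)
    also have "\<dots> \<le> ennreal (2 powr p) * (ennreal (norm z powr p) * ennreal m + ennreal (norm w powr p) * ennreal m)"
      by (intro mult_left_mono add_mono T_y T_c) auto
    also have "\<dots> = ennreal K"
      by (simp add: K_def flip: ennreal_mult ennreal_plus)
    finally show ?thesis .
  qed
  show ?thesis
  proof (rule that[OF K])
    fix a assume "a \<in> dp p"
    then obtain r where r: "0 \<le> r" "dp_sum p a = ennreal r"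
      unfolding dp_def by (cases "dp_sum p a") auto
    show "dp_sum p (T a) \<le> ennreal K * dp_sum p a"
    proof (cases "r = 0")
      case True
      then have "a = (\<lambda>_. 0)"
        using r by (intro dp_sum_eq_0D[of p]) simp
      then have "T a = (\<lambda>_. 0)"
        using scale[of 0 a] by simp
      then show ?thesis
        by (simp add: dp_sum_def)
    next
      case False
      \<comment> \<open>\<open>s\<close> is the norm of \<open>a\<close>, so that \<open>a / s\<close> lies in \<open>B\<close>.\<close>
      define s where "s = r powr (1 / p)"
      have s: "0 < s" "s powr p = r"
        using False r(1) p by (simp_all add: s_def powr_powr)
      define u where "u = (\<lambda>n. complex_of_real (1 / s) * a n)"
      have "dp_sum p u = ennreal ((1 / s) powr p * r)"
        unfolding u_def dp_sum_scale r(2) using s r(1) by (simp add: ennreal_mult' norm_divide)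
      also have "(1 / s) powr p * r = 1"
        using s False by (simp add: powr_divide)
      finally have "u \<in> B"
        by (simp add: B_def)
      have "a = (\<lambda>n. complex_of_real s * u n)"
        using s by (simp add: u_def)
      then have "T a = (\<lambda>n. complex_of_real s * T u n)"
        by (simp only: scale)
      then have "dp_sum p (T a) = ennreal r * dp_sum p (T u)"
        using s by (simp add: dp_sum_scale)
      also have "\<dots> \<le> ennreal r * ennreal K"
        by (intro mult_left_mono T_B[OF \<open>u \<in> B\<close>]) auto
      finally show ?thesis
        by (simp add: r(2) mult.commute)
    qed
  qed
qed

lemma conv_op_in_bounded_ops:
  assumes p: "1 \<le> p" and b: "b \<in> multipliers p"
  shows "conv_op p b \<in> bounded_ops p"
proof -
  have maps: "conv a b \<in> dp p" if "a \<in> dp p" for a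
    using b that by (simp add: multipliers_def)
  have "continuous_on UNIV (\<lambda>a. conv a b)"
    unfolding conv_def
    by (intro continuous_on_coordinatewise_then_product continuous_intros)
      (rule continuous_on_product_coordinates)
  from dp_sum_bound_if_coordinatewise_continuous[OF p this conv_add_left conv_scale_left maps]
  obtain K where K: "0 \<le> K" "\<And>a. a \<in> dp p \<Longrightarrow> dp_sum p (conv a b) \<le> ennreal K * dp_sum p a"
    by blast
  have "dp_norm p (conv a b) \<le> K powr (1 / p) * dp_norm p a" if a: "a \<in> dp p" for a
  proof -
    have "enn2real (dp_sum p (conv a b)) \<le> enn2real (ennreal K * dp_sum p a)"
      using K(2)[OF a] a by (intro enn2real_mono) (auto simp: dp_def ennreal_mult_less_top)
    also have "\<dots> = K * enn2real (dp_sum p a)"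
      using K(1) by (simp add: enn2real_mult)
    finally have "dp_norm p (conv a b) \<le> (K * enn2real (dp_sum p a)) powr (1 / p)"
      unfolding dp_norm_def using p by (intro powr_mono2) auto
    then show ?thesis
      using K(1) by (simp add: dp_norm_def powr_mult)
  qed
  then show ?thesis
    using maps p unfolding bounded_ops_def conv_op_def
    by (auto simp: dp_add dp_scale conv_add_left conv_scale_left)
qed

section \<open>Operators commuting with the shift\<close>

lemma right_shift_eq_conv_op: "right_shift p = conv_op p (case_nat 0 unit_seq)"
  by (simp add: right_shift_def conv_op_def conv_shifted_unit_seq)

lemma shifted_unit_seq_multiplier: "case_nat 0 unit_seq \<in> multipliers p"
  by (simp add: multipliers_def conv_shifted_unit_seq dp_case_nat)

text \<open>
  Splitting off the first entry of \<open>a\<close> expresses entry \<open>n + 1\<close> of \<open>R a\<close> through entry \<open>n\<close> of \<open>R\<close> applied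
  to the tail of \<open>a\<close>. Convolution with \<open>R unit_seq\<close> obeys the same recursion, by \<open>conv_Suc\<close>.
\<close>

lemma shift_commuting_eq_conv:
  assumes R: "R \<in> bounded_ops p"
    and commutes: "compose (dp p) R (right_shift p) = compose (dp p) (right_shift p) R"
    and a: "a \<in> dp p"
  shows "R a = conv a (R unit_seq)"
proof
  have R_dp: "R a \<in> dp p" if "a \<in> dp p" for a
    using R that by (auto simp: bounded_ops_def)
  have unit: "unit_seq \<in> dp p"
    by (intro dp_case_nat dp_zero)
  have shift: "R (case_nat 0 a) = case_nat 0 (R a)" if "a \<in> dp p" for a
    using fun_cong[OF commutes, of a] that R_dp[OF that]
    by (simp add: compose_def right_shift_def)
  have step: "R a n = a 0 * R unit_seq n + case_nat 0 (R (\<lambda>n. a (Suc n))) n" if "a \<in> dp p" for a n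
  proof -
    let ?tail = "\<lambda>n. a (Suc n)"
    have "a = (\<lambda>n. a 0 * unit_seq n + case_nat 0 ?tail n)"
      by (auto simp: fun_eq_iff split: nat.split)
    then have "R a = R (\<lambda>n. a 0 * unit_seq n + case_nat 0 ?tail n)"
      by simp
    also have "\<dots> = (\<lambda>n. R (\<lambda>n. a 0 * unit_seq n) n + R (case_nat 0 ?tail) n)"
      using R dp_scale[OF unit] dp_case_nat[OF dp_tail[OF that]] by (simp add: bounded_ops_def)
    also have "R (\<lambda>n. a 0 * unit_seq n) = (\<lambda>n. a 0 * R unit_seq n)"
      using R unit by (simp add: bounded_ops_def)
    also have "R (case_nat 0 ?tail) = case_nat 0 (R ?tail)"
      by (rule shift[OF dp_tail[OF that]])
    finally show ?thesis
      by simp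
  qed
  fix n
  show "R a n = conv a (R unit_seq) n"
    using a
  proof (induction n arbitrary: a)
    case 0
    then show ?case
      using step[of a 0] by (simp add: conv_0)
  next
    case (Suc n)
    then show ?case
      using step[OF Suc.prems, of "Suc n"] Suc.IH[OF dp_tail[OF Suc.prems]] by (simp add: conv_Suc)
  qed
qed

lemma shift_commuting_imp_multiplier_op:
  assumes R: "R \<in> bounded_ops p"
    and commutes: "compose (dp p) R (right_shift p) = compose (dp p) (right_shift p) R"
  shows "R \<in> multiplier_ops p"
proof -
  have eq: "R a = conv a (R unit_seq)" if "a \<in> dp p" for a
    using shift_commuting_eq_conv[OF R commutes that] .
  have "R = conv_op p (R unit_seq)"
  proof (rule extensionalityI)
    show "R \<in> extensional (dp p)"
      using R by (simp add: bounded_ops_def PiE_def)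
  qed (simp_all add: conv_op_def flip: eq)
  moreover have "R unit_seq \<in> multipliers p"
    using R by (auto simp: multipliers_def bounded_ops_def simp flip: eq)
  ultimately show ?thesis
    unfolding multiplier_ops_def by blast
qed

theorem proposition3p1:
  fixes p :: real
  assumes "1 \<le> p"
  shows "multiplier_ops p =
           {R \<in> bounded_ops p. compose (dp p) R (right_shift p) = compose (dp p) (right_shift p) R}
       \<and> multiplier_ops p = commutant p (multiplier_ops p)
       \<and> commutant p (multiplier_ops p) = commutant p (commutant p (multiplier_ops p))"
proof -
  let ?M = "multiplier_ops p"
  let ?C = "{R \<in> bounded_ops p. compose (dp p) R (right_shift p) = compose (dp p) (right_shift p) R}"
  have M_commutant: "?M \<subseteq> commutant p ?M"
  proof -
    have "compose (dp p) (conv_op p b) (conv_op p c) = compose (dp p) (conv_op p c) (conv_op p b)"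
      if "b \<in> multipliers p" "c \<in> multipliers p" for b c
      using that by (auto simp: fun_eq_iff compose_def conv_op_def multipliers_def conv_conv_commute)
    then show ?thesis
      using conv_op_in_bounded_ops[OF assms] by (auto simp: multiplier_ops_def commutant_def)
  qed
  moreover have "commutant p ?M \<subseteq> ?C"
    using shifted_unit_seq_multiplier[of p]
    by (auto simp: commutant_def multiplier_ops_def right_shift_eq_conv_op)
  moreover have "?C \<subseteq> ?M"
    using shift_commuting_imp_multiplier_op by blast
  ultimately have "?M = ?C" "commutant p ?M = ?M"
    by auto
  then show ?thesis
    by simp
qed

end
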